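(* Let a GNEP with twice continuously differentiable defining functions $(f,g,G)$ be given, and let parameters $r=(r^\nu,\nu\in\mathcal{N})$ with $r^\nu>0$ for all $\nu\in\mathcal{N}$ be arbitrary, but fixed. Then every nondegenerate normalized KKT-point $\bar x$ associated with $r$ is locally unique, i.e. there exists a neighborhood of $\bar x$ in $\mathbb{R}^n$ containing no normalized KKT-point associated with the same $r$ other than $\bar x$. In particular, every nondegenerate normalized Nash equilibrium associated with $r$ is locally unique, i.e. has a neighborhood containing no other normalized Nash equilibrium associated with $r$.
   Context: Setting. Let $\mathcal{N}=\{1,\ldots,N\}$ be a finite set of players, $n_\nu$ ($\nu\in\mathcal{N}$) the dimension of player $\nu$'s strategy $x^\nu\in\mathbb{R}^{n_\nu}$, $n=\sum_{\nu=1}^N n_\nu$, and write $x=(x^1,\ldots,x^N)=(x^\nu,x^{-\nu})\in\mathbb{R}^n$. Let $\mathcal{J}=\{1,\ldots,|\mathcal{J}|\}$ (shared constraints) and $\mathcal{J}^\nu=\{1,\ldots,|\mathcal{J}^\nu|\}$ (individual constraints of player $\nu$) be fixed finite index sets. A generalized Nash equilibrium problem (GNEP) is given by twice continuously differentiable defining functions $f=(f^\nu,\nu\in\mathcal{N})$ with $f^\nu:\mathbb{R}^n\to\mathbb{R}$, $g=(g^\nu_j, j\in\mathcal{J}^\nu,\nu\in\mathcal{N})$ with $g^\nu_j:\mathbb{R}^{n_\nu}\to\mathbb{R}$, and $G=(G_j,j\in\mathcal{J})$ with $G_j:\mathbb{R}^n\to\mathbb{R}$. Player $\nu$'s problem $P_\nu(x^{-\nu})$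 is to minimize $f^\nu(x^\nu,x^{-\nu})$ over $x^\nu\in\mathbb{R}^{n_\nu}$ subject to $g^\nu_j(x^\nu)\ge 0$, $j\in\mathcal{J}^\nu$, and $G_j(x^\nu,x^{-\nu})\ge 0$, $j\in\mathcal{J}$. $D$ denotes gradients as row vectors (Jacobians for vector-valued maps) and $D_{x^\nu}$ the partial gradient with respect to $x^\nu$. Feasible set. $X=\{x\in\mathbb{R}^n : g^\nu_j(x^\nu)\ge 0,\ j\in\mathcal{J}^\nu,\ \nu\in\mathcal{N},\ G_j(x)\ge 0,\ j\in\mathcal{J}\}$. Active index sets: $\mathcal{J}_0(\bar x)=\{j\in\mathcal{J}: G_j(\bar x)=0\}$ and $\mathcal{J}^\nu_0(\bar x^\nu)=\{j\in\mathcal{J}^\nu: g^\nu_j(\bar x^\nu)=0\}$. Normalized Nash equilibrium. $\bar x\in X$ is a Nash equilibrium if $\bar x^\nu$ solves $P_\nu(\bar x^{-\nu})$ for each $\nu\in\mathcal{N}$. It is normalized, associated with $r>0$, if there exist real multipliers $\bar\lambda^\nu_j$ ($j\in\mathcal{J}^\nu$) and $\bar\Lambda^\nu_j$ ($j\in\mathcal{J}$), $\nu\in\mathcal{N}$, such that for every $\nu$: $D_{x^\nu}f^\nu(\bar x)=\sum_{j\in\mathcal{J}^\nu}\bar\lambda^\nu_jDg^\nu_j(\bar x^\nu)+\sum_{j\in\mathcal{J}}\bar\Lambda^\nu_jD_{x^\nu}G_j(\bar x)$; $\bar\lambda^\nu_jg^\nu_j(\bar x^\nu)=0$, $\bar\lambda^\nu_j\ge0$,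 $g^\nu_j(\bar x^\nu)\ge0$ for $j\in\mathcal{J}^\nu$; $\bar\Lambda^\nu_jG_j(\bar x)=0$, $\bar\Lambda^\nu_j\ge0$, $G_j(\bar x)\ge0$ for $j\in\mathcal{J}$; and $r^1\bar\Lambda^1_j=\cdots=r^N\bar\Lambda^N_j$ for $j\in\mathcal{J}$. Normalized KKT-point. $\bar x\in X$ is a normalized KKT-point associated with $r>0$ if there exist real multipliers $\bar\lambda^\nu_j$ ($j\in\mathcal{J}^\nu$, $\nu\in\mathcal{N}$) and $\bar\Lambda_j$ ($j\in\mathcal{J}$) such that for all $\nu\in\mathcal{N}$ $$r^\nu D_{x^\nu}f^\nu(\bar x)=\sum_{j\in\mathcal{J}^\nu}\bar\lambda^\nu_j Dg^\nu_j(\bar x^\nu)+\sum_{j\in\mathcal{J}}\bar\Lambda_j D_{x^\nu}G_j(\bar x),$$ $\bar\lambda^\nu_j g^\nu_j(\bar x^\nu)=0$, $\bar\lambda^\nu_j\ge0$, $g^\nu_j(\bar x^\nu)\ge 0$ for $j\in\mathcal{J}^\nu$, and $\bar\Lambda_jG_j(\bar x)=0$, $\bar\Lambda_j\ge0$, $G_j(\bar x)\ge0$ for $j\in\mathcal{J}$. Every normalized Nash equilibrium associated with $r$ is a normalized KKT-point associated with $r$ (rescale the multipliers by $r^\nu$); it is called nondegenerate if it is nondegenerate as a normalized KKT-point. GNEP-LICQ. $\bar x\in X$ satisfies GNEP-LICQ if the linear system $\sum_{j\in\mathcal{J}^\nu_0(\bar x^\nu)}\lambda^\nu_j Dg^\nu_j(\bar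 x^\nu)+\sum_{j\in\mathcal{J}_0(\bar x)}\Lambda_j D_{x^\nu}G_j(\bar x)=0$, $\nu\in\mathcal{N}$ (with the same $\Lambda_j$ for all $\nu$), admits only the trivial solution. Under GNEP-LICQ the multipliers of a normalized KKT-point associated with $r$ are unique; one writes $\bar\lambda=(\bar\lambda^\nu_j, j\in\mathcal{J}^\nu_0(\bar x^\nu),\nu\in\mathcal{N})$ and $\bar\Lambda=(\bar\Lambda_j,j\in\mathcal{J}_0(\bar x))$, omitting the zero multipliers of inactive constraints. Lagrange functions and pseudogradient. For $\nu\in\mathcal{N}$ let $$L^\nu(x,\lambda,\Lambda,r)=r^\nu f^\nu(x)-\sum_{j\in\mathcal{J}^\nu_0(\bar x^\nu)}\lambda^\nu_j g^\nu_j(x^\nu)-\sum_{j\in\mathcal{J}_0(\bar x)}\Lambda_jG_j(x),$$ and $\mathcal{G}_L(x,\lambda,\Lambda,r)=(D_{x^\nu}L^\nu(x,\lambda,\Lambda,r),\nu\in\mathcal{N})^T\in\mathbb{R}^n$, with $(n\times n)$ Jacobian $D_x\mathcal{G}_L$ with respect to $x$. Let $$\mathcal{T}_{\bar x}X_0(\bar x)=\{\xi\in\mathbb{R}^n: Dg^\nu_j(\bar x^\nu)\xi^\nu=0,\ j\in\mathcal{J}^\nu_0(\bar x^\nu),\ \nu\in\mathcal{N},\ DG_j(\bar x)\xi=0,\ j\in\mathcal{J}_0(\bar x)\}.$$ Nondegeneracy. A normalized KKT-point $\bar x$ associated with $r>0$ is nondegenerate if: (ND1) GNEP-LICQ holds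 at $\bar x$; (ND2) $\bar\lambda^\nu_j>0$ for all $j\in\mathcal{J}^\nu_0(\bar x^\nu)$, $\nu\in\mathcal{N}$, and $\bar\Lambda_j>0$ for all $j\in\mathcal{J}_0(\bar x)$; (ND3) the matrix $V^TD_x\mathcal{G}_L(\bar x,\bar\lambda,\bar\Lambda,r)V$ is nonsingular, where $V$ is some matrix whose columns form a basis of $\mathcal{T}_{\bar x}X_0(\bar x)$ (trivially satisfied if $\mathcal{T}_{\bar x}X_0(\bar x)=\{0\}$). *)

theory Defs
  imports "HOL-Analysis.Analysis" "Jordan_Normal_Form.Matrix"
begin

unbundle no vec_syntax
no_notation Matrix.vec_index (infixl \<open>$\<close> 100)
no_notation Matrix.scalar_prod (infix \<open>\<bullet>\<close> 70)
unbundle vec_syntax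

text \<open>
  The type \<open>'p\<close> is the set of players and \<open>'i\<close> the set of all scalar coordinates, so that
  \<open>real^'i\<close> is the space of strategy profiles.  Every coordinate is owned by exactly one player;
  the strategy of player \<open>\<nu>\<close> consists of the coordinates \<open>i\<close> with \<open>owner P i = \<nu>\<close>, and its dimension
  is the number of these.  A function of player \<open>\<nu>\<close>'s strategy alone is represented by
  a function on \<open>real^'i\<close> that only depends on the coordinates of \<open>\<nu>\<close>.
  The index sets of the constraints may be empty.
\<close>

record ('i, 'p, 'j, 'k) gnep =
  owner :: "'i \<Rightarrow> 'p"
  Jshared :: "'j set"
  Jindiv :: "'p \<Rightarrow> 'k set"
  obj :: "'p \<Rightarrow> real^'i \<Rightarrow> real"
  gcon :: "'p \<Rightarrow> 'k \<Rightarrow> real^'i \<Rightarrow> real"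
  Gcon :: "'j \<Rightarrow> real^'i \<Rightarrow> real"

definition grad :: "(real^'i \<Rightarrow> real) \<Rightarrow> real^'i \<Rightarrow> real^'i::finite" where
  "grad h x = (\<chi> i. frechet_derivative h (at x) (axis i 1))"

definition C2_fun :: "(real^'i::finite \<Rightarrow> real) \<Rightarrow> bool" where
  "C2_fun h \<longleftrightarrow>
     (\<forall>x. h differentiable (at x)) \<and>
     (\<forall>x. grad h differentiable (at x)) \<and>
     continuous_on UNIV (\<lambda>x. jacobian (grad h) (at x))"

definition depends_only_on :: "('i \<Rightarrow> 'p) \<Rightarrow> 'p \<Rightarrow> (real^'i::finite \<Rightarrow> real) \<Rightarrow> bool" where
  "depends_only_on own \<nu> h \<longleftrightarrow> (\<forall>x y. (\<forall>i. own i = \<nu> \<longrightarrow> x $ i = y $ i) \<longrightarrow> h x = h y)"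

definition GNEP :: "('i::finite, 'p::finite, 'j, 'k) gnep \<Rightarrow> bool" where
  "GNEP P \<longleftrightarrow>
     finite (Jshared P) \<and> (\<forall>\<nu>. finite (Jindiv P \<nu>)) \<and>
     (\<forall>\<nu>. C2_fun (obj P \<nu>)) \<and>
     (\<forall>\<nu>. \<forall>j\<in>Jindiv P \<nu>. C2_fun (gcon P \<nu> j) \<and> depends_only_on (owner P) \<nu> (gcon P \<nu> j)) \<and>
     (\<forall>j\<in>Jshared P. C2_fun (Gcon P j))"

text \<open>
  \<open>pgrad P \<nu> h x\<close> is the partial gradient of \<open>h\<close> with respect to the strategy of \<open>\<nu>\<close>, padded with
  zeros in the coordinates of the other players.  For a function \<open>h\<close> of \<open>\<nu>\<close>'s strategy alone
  it represents the full gradient.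
\<close>

definition pgrad ::
  "('i::finite, 'p, 'j, 'k) gnep \<Rightarrow> 'p \<Rightarrow> (real^'i \<Rightarrow> real) \<Rightarrow> real^'i \<Rightarrow> real^'i" where
  "pgrad P \<nu> h x = (\<chi> i. if owner P i = \<nu> then grad h x $ i else 0)"

definition feasible_set :: "('i::finite, 'p, 'j, 'k) gnep \<Rightarrow> (real^'i) set" where
  "feasible_set P =
     {x. (\<forall>\<nu>. \<forall>j\<in>Jindiv P \<nu>. gcon P \<nu> j x \<ge> 0) \<and> (\<forall>j\<in>Jshared P. Gcon P j x \<ge> 0)}"

definition active_shared :: "('i::finite, 'p, 'j, 'k) gnep \<Rightarrow> real^'i \<Rightarrow> 'j set" where
  "active_shared P xb = {j \<in> Jshared P. Gcon P j xb = 0}"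

definition active_indiv :: "('i::finite, 'p, 'j, 'k) gnep \<Rightarrow> 'p \<Rightarrow> real^'i \<Rightarrow> 'k set" where
  "active_indiv P \<nu> xb = {j \<in> Jindiv P \<nu>. gcon P \<nu> j xb = 0}"

text \<open>The profile in which player \<open>\<nu>\<close> plays as in \<open>y\<close> and all others play as in \<open>x\<close>.\<close>

definition combine :: "('i::finite, 'p, 'j, 'k) gnep \<Rightarrow> 'p \<Rightarrow> real^'i \<Rightarrow> real^'i \<Rightarrow> real^'i" where
  "combine P \<nu> y x = (\<chi> i. if owner P i = \<nu> then y $ i else x $ i)"

definition player_feasible :: "('i::finite, 'p, 'j, 'k) gnep \<Rightarrow> 'p \<Rightarrow> real^'i \<Rightarrow> real^'i \<Rightarrow> bool" where
  "player_feasible P \<nu> x y \<longleftrightarrow>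
     (\<forall>j\<in>Jindiv P \<nu>. gcon P \<nu> j y \<ge> 0) \<and> (\<forall>j\<in>Jshared P. Gcon P j (combine P \<nu> y x) \<ge> 0)"

text \<open>Only the coordinates of \<open>\<nu>\<close> in \<open>y\<close> and those of the other players in \<open>x\<close> matter here.\<close>

definition solves_player_problem ::
  "('i::finite, 'p, 'j, 'k) gnep \<Rightarrow> 'p \<Rightarrow> real^'i \<Rightarrow> real^'i \<Rightarrow> bool" where
  "solves_player_problem P \<nu> x y \<longleftrightarrow>
     player_feasible P \<nu> x y \<and>
     (\<forall>z. player_feasible P \<nu> x z \<longrightarrow>
        obj P \<nu> (combine P \<nu> y x) \<le> obj P \<nu> (combine P \<nu> z x))"

definition nash_equilibrium :: "('i::finite, 'p, 'j, 'k) gnep \<Rightarrow> real^'i \<Rightarrow> bool" where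
  "nash_equilibrium P xb \<longleftrightarrow> xb \<in> feasible_set P \<and> (\<forall>\<nu>. solves_player_problem P \<nu> xb xb)"

definition normalized_nash ::
  "('i::finite, 'p, 'j, 'k) gnep \<Rightarrow> ('p \<Rightarrow> real) \<Rightarrow> real^'i \<Rightarrow> bool" where
  "normalized_nash P r xb \<longleftrightarrow> nash_equilibrium P xb \<and>
     (\<exists>lam Lam.
        (\<forall>\<nu>. pgrad P \<nu> (obj P \<nu>) xb =
               (\<Sum>j\<in>Jindiv P \<nu>. lam \<nu> j *\<^sub>R pgrad P \<nu> (gcon P \<nu> j) xb) +
               (\<Sum>j\<in>Jshared P. Lam \<nu> j *\<^sub>R pgrad P \<nu> (Gcon P j) xb)) \<and>
        (\<forall>\<nu>. \<forall>j\<in>Jindiv P \<nu>. lam \<nu> j * gcon P \<nu> j xb = 0 \<and> lam \<nu> j \<ge> 0 \<and> gcon P \<nu> j xb \<ge> 0) \<and>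
        (\<forall>\<nu>. \<forall>j\<in>Jshared P. Lam \<nu> j * Gcon P j xb = 0 \<and> Lam \<nu> j \<ge> 0 \<and> Gcon P j xb \<ge> 0) \<and>
        (\<forall>\<nu> \<mu>. \<forall>j\<in>Jshared P. r \<nu> * Lam \<nu> j = r \<mu> * Lam \<mu> j))"

definition KKT_multipliers ::
  "('i::finite, 'p, 'j, 'k) gnep \<Rightarrow> ('p \<Rightarrow> real) \<Rightarrow> real^'i \<Rightarrow>
     ('p \<Rightarrow> 'k \<Rightarrow> real) \<Rightarrow> ('j \<Rightarrow> real) \<Rightarrow> bool" where
  "KKT_multipliers P r xb lam Lam \<longleftrightarrow>
     (\<forall>\<nu>. r \<nu> *\<^sub>R pgrad P \<nu> (obj P \<nu>) xb =
            (\<Sum>j\<in>Jindiv P \<nu>. lam \<nu> j *\<^sub>R pgrad P \<nu> (gcon P \<nu> j) xb) +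
            (\<Sum>j\<in>Jshared P. Lam j *\<^sub>R pgrad P \<nu> (Gcon P j) xb)) \<and>
     (\<forall>\<nu>. \<forall>j\<in>Jindiv P \<nu>. lam \<nu> j * gcon P \<nu> j xb = 0 \<and> lam \<nu> j \<ge> 0 \<and> gcon P \<nu> j xb \<ge> 0) \<and>
     (\<forall>j\<in>Jshared P. Lam j * Gcon P j xb = 0 \<and> Lam j \<ge> 0 \<and> Gcon P j xb \<ge> 0)"

definition normalized_KKT ::
  "('i::finite, 'p, 'j, 'k) gnep \<Rightarrow> ('p \<Rightarrow> real) \<Rightarrow> real^'i \<Rightarrow> bool" where
  "normalized_KKT P r xb \<longleftrightarrow>
     xb \<in> feasible_set P \<and> (\<exists>lam Lam. KKT_multipliers P r xb lam Lam)"

definition GNEP_LICQ :: "('i::finite, 'p, 'j, 'k) gnep \<Rightarrow> real^'i \<Rightarrow> bool" where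
  "GNEP_LICQ P xb \<longleftrightarrow>
     (\<forall>lam Lam.
        (\<forall>\<nu>. (\<Sum>j\<in>active_indiv P \<nu> xb. lam \<nu> j *\<^sub>R pgrad P \<nu> (gcon P \<nu> j) xb) +
             (\<Sum>j\<in>active_shared P xb. Lam j *\<^sub>R pgrad P \<nu> (Gcon P j) xb) = 0) \<longrightarrow>
        (\<forall>\<nu>. \<forall>j\<in>active_indiv P \<nu> xb. lam \<nu> j = 0) \<and> (\<forall>j\<in>active_shared P xb. Lam j = 0))"

text \<open>The active index sets below are taken at the reference point \<open>xb\<close>, not at \<open>x\<close>.\<close>

definition lagrangian ::
  "('i::finite, 'p, 'j, 'k) gnep \<Rightarrow> real^'i \<Rightarrow> 'p \<Rightarrow> ('p \<Rightarrow> 'k \<Rightarrow> real) \<Rightarrow> ('j \<Rightarrow> real) \<Rightarrow>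
     ('p \<Rightarrow> real) \<Rightarrow> real^'i \<Rightarrow> real" where
  "lagrangian P xb \<nu> lam Lam r x =
     r \<nu> * obj P \<nu> x - (\<Sum>j\<in>active_indiv P \<nu> xb. lam \<nu> j * gcon P \<nu> j x)
       - (\<Sum>j\<in>active_shared P xb. Lam j * Gcon P j x)"

definition pseudogradient ::
  "('i::finite, 'p, 'j, 'k) gnep \<Rightarrow> real^'i \<Rightarrow> ('p \<Rightarrow> 'k \<Rightarrow> real) \<Rightarrow> ('j \<Rightarrow> real) \<Rightarrow>
     ('p \<Rightarrow> real) \<Rightarrow> real^'i \<Rightarrow> real^'i" where
  "pseudogradient P xb lam Lam r x =
     (\<chi> i. grad (lagrangian P xb (owner P i) lam Lam r) x $ i)"

definition tangent_space :: "('i::finite, 'p, 'j, 'k) gnep \<Rightarrow> real^'i \<Rightarrow> (real^'i) set" where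
  "tangent_space P xb =
     {\<xi>. (\<forall>\<nu>. \<forall>j\<in>active_indiv P \<nu> xb. pgrad P \<nu> (gcon P \<nu> j) xb \<bullet> \<xi> = 0) \<and>
         (\<forall>j\<in>active_shared P xb. grad (Gcon P j) xb \<bullet> \<xi> = 0)}"

definition is_basis_of :: "'a::real_vector list \<Rightarrow> 'a set \<Rightarrow> bool" where
  "is_basis_of vs T \<longleftrightarrow> distinct vs \<and> independent (set vs) \<and> span (set vs) = T"

text \<open>
  For the matrix \<open>V\<close> with the list of columns \<open>vs\<close>, this is the product of the transpose of \<open>V\<close>, \<open>M\<close>
  and \<open>V\<close>.  Its size depends on the dimension of the tangent space and may be zero, in which
  case the matrix is invertible.
\<close>

definition restricted_matrix :: "(real^'i) list \<Rightarrow> real^'i^'i::finite \<Rightarrow> real mat" where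
  "restricted_matrix vs M =
     Matrix.mat (length vs) (length vs) (\<lambda>(a, b). (vs ! a) \<bullet> (M *v (vs ! b)))"

text \<open>
  Under GNEP-LICQ the multipliers are unique on the index sets of the constraints, so the existential
  quantifier over them merely names them; the basis is likewise quantified existentially.
\<close>

definition nondegenerate_KKT ::
  "('i::finite, 'p, 'j, 'k) gnep \<Rightarrow> ('p \<Rightarrow> real) \<Rightarrow> real^'i \<Rightarrow> bool" where
  "nondegenerate_KKT P r xb \<longleftrightarrow>
     normalized_KKT P r xb \<and>
     GNEP_LICQ P xb \<and>
     (\<exists>lam Lam. KKT_multipliers P r xb lam Lam \<and>
        (\<forall>\<nu>. \<forall>j\<in>active_indiv P \<nu> xb. lam \<nu> j > 0) \<and>
        (\<forall>j\<in>active_shared P xb. Lam j > 0) \<and>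
        (\<exists>vs. is_basis_of vs (tangent_space P xb) \<and>
           invertible_mat
             (restricted_matrix vs (jacobian (pseudogradient P xb lam Lam r) (at xb)))))"

definition nondegenerate_nash ::
  "('i::finite, 'p, 'j, 'k) gnep \<Rightarrow> ('p \<Rightarrow> real) \<Rightarrow> real^'i \<Rightarrow> bool" where
  "nondegenerate_nash P r xb \<longleftrightarrow> normalized_nash P r xb \<and> nondegenerate_KKT P r xb"

definition locally_unique :: "('a::topological_space \<Rightarrow> bool) \<Rightarrow> 'a \<Rightarrow> bool" where
  "locally_unique Q xb \<longleftrightarrow> (\<exists>U. open U \<and> xb \<in> U \<and> (\<forall>x\<in>U. Q x \<longrightarrow> x = xb))"

end

theory Submission
  imports Defs
begin

text \<open>
  Stack the stationarity conditions of all players into one equation in the space of strategy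
  profiles: the weighted pseudogradient of the objectives is a linear combination of the gradients
  of the active constraints.  This is possible because all players share the multipliers \<open>\<Lambda>\<close>, so a
  shared constraint contributes its full gradient, while an individual constraint contributes a
  gradient supported on the coordinates of its player.  GNEP-LICQ says precisely that these
  stacked gradients are linearly independent.

  Suppose that KKT points \<open>x\<^sub>n \<noteq> xb\<close> with multipliers \<open>c\<^sub>n\<close> converge to \<open>xb\<close>; let \<open>\<mu>\<close> be the
  multipliers at \<open>xb\<close> and \<open>R\<close> the pseudogradient of the Lagrange functions for the fixed
  multipliers \<open>\<mu>\<close>.  Then \<open>R xb = 0\<close>, and \<open>R x\<^sub>n\<close> is the combination of the active gradients at \<open>x\<^sub>n\<close>
  with coefficients \<open>c\<^sub>n - \<mu>\<close>.  Independence of the gradients survives a small perturbation with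
  uniform bounds (\<open>independent_family_coeffs_bounded\<close>), so \<open>c\<^sub>n - \<mu>\<close> is of the order of
  \<open>\<parallel>x\<^sub>n - xb\<parallel>\<close>.  In particular \<open>c\<^sub>n\<close> tends to \<open>\<mu> > 0\<close>, and complementarity keeps every constraint
  that is active at \<open>xb\<close> active at \<open>x\<^sub>n\<close>.  Hence a limit \<open>l\<close> of the unit directions from \<open>xb\<close> to
  \<open>x\<^sub>n\<close> lies in the tangent space \<open>T\<close>.  Dividing the equation for \<open>R x\<^sub>n\<close> by \<open>\<parallel>x\<^sub>n - xb\<parallel>\<close> and
  testing it with \<open>v \<in> T\<close> gives \<open>v \<bullet> D l = 0\<close> in the limit, where \<open>D\<close> is the derivative of \<open>R\<close> at
  \<open>xb\<close>, because \<open>v\<close> is orthogonal to all active gradients at \<open>xb\<close>.  Nonsingularity of \<open>D\<close> on \<open>T\<close>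
  then forces \<open>l = 0\<close>, although \<open>l\<close> is a unit vector.  This is
  \<open>nondegenerate_stationary_point_isolated\<close>.

  It applies to KKT points near \<open>xb\<close> because constraints inactive at \<open>xb\<close> remain inactive, so that
  their multipliers vanish (\<open>KKT_multipliers_imp_stacked\<close>).  The claim about equilibria follows since
  every normalized Nash equilibrium is a normalized KKT point (\<open>normalized_nash_imp_KKT\<close>).
\<close>

section \<open>Linearly independent families under perturbation\<close>

text \<open>
  Members of the dual family: each coefficient of a combination of an independent family is a
  linear, hence bounded, function of the combination.
\<close>

lemma independent_family_functional:
  fixes a :: "'c \<Rightarrow> 'v::euclidean_space"
  assumes K: "finite K" "l \<in> K"
    and indep: "\<And>c. (\<Sum>k\<in>K. c k *\<^sub>R a k) = 0 \<Longrightarrow> \<forall>k\<in>K. c k = 0"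
  obtains \<phi> :: "'v \<Rightarrow> real" where "linear \<phi>" "\<And>c. \<phi> (\<Sum>k\<in>K. c k *\<^sub>R a k) = c l"
proof -
  have inj: "inj_on a K"
  proof (rule inj_onI, rule ccontr)
    fix i j assume ij: "i \<in> K" "j \<in> K" "a i = a j" "i \<noteq> j"
    \<comment> \<open>a repeated vector would give the nontrivial relation \<open>a i - a j = 0\<close>\<close>
    let ?c = "\<lambda>k. (if k = i then 1 else 0) - (if k = j then 1 else (0::real))"
    have "(\<Sum>k\<in>K. ?c k *\<^sub>R a k)
        = (\<Sum>k\<in>K. if k = i then a k else 0) - (\<Sum>k\<in>K. if k = j then a k else 0)"
      by (auto simp: sum_subtractf[symmetric] scaleR_diff_left intro!: sum.cong)
    also have "\<dots> = 0" using ij K by simp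
    finally have "\<forall>k\<in>K. ?c k = 0" by (rule indep)
    then show False using ij by force
  qed
  have ind: "independent (a ` K)"
  proof (rule independent_if_scalars_zero)
    show "finite (a ` K)" using K by simp
    fix f x assume z: "(\<Sum>x\<in>a ` K. f x *\<^sub>R x) = 0" and x: "x \<in> a ` K"
    have "(\<Sum>k\<in>K. f (a k) *\<^sub>R a k) = 0" using z by (simp add: sum.reindex[OF inj])
    from indep[OF this] x show "f x = 0" by auto
  qed
  obtain \<phi> :: "'v \<Rightarrow> real" where lin: "linear \<phi>"
      and \<phi>: "\<forall>x\<in>a ` K. \<phi> x = (if x = a l then 1 else 0)"
    using linear_independent_extend[OF ind, of "\<lambda>x. if x = a l then 1 else (0::real)"]
    by (elim exE conjE)
  have "\<phi> (\<Sum>k\<in>K. c k *\<^sub>R a k) = c l" for c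
  proof -
    have "\<phi> (\<Sum>k\<in>K. c k *\<^sub>R a k) = (\<Sum>k\<in>K. c k * \<phi> (a k))"
      using lin by (simp add: linear_sum linear_cmul)
    also have "\<dots> = (\<Sum>k\<in>K. if k = l then c k else 0)"
      using \<phi> inj K by (intro sum.cong) (auto simp: inj_on_def)
    finally show ?thesis using K by simp
  qed
  with lin show thesis by (rule that)
qed

text \<open>
  The constant does not depend on the coefficients: the dual functionals bound them by the
  combination of the limit vectors, and once the perturbation is small relative to that bound, the
  error made by replacing the limit vectors is absorbed into half of the left-hand side.
\<close>

lemma independent_family_coeffs_bounded:
  fixes a :: "'c \<Rightarrow> 'v::euclidean_space" and A :: "'c \<Rightarrow> 'n \<Rightarrow> 'v"
  assumes K: "finite K"
    and indep: "\<And>c. (\<Sum>k\<in>K. c k *\<^sub>R a k) = 0 \<Longrightarrow> \<forall>k\<in>K. c k = 0"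
    and lim: "\<And>k. k \<in> K \<Longrightarrow> (A k \<longlongrightarrow> a k) F"
  obtains C where "C > 0" "\<forall>\<^sub>F n in F. \<forall>c. (\<Sum>k\<in>K. \<bar>c k\<bar>) \<le> C * norm (\<Sum>k\<in>K. c k *\<^sub>R A k n)"
proof -
  have "\<forall>l\<in>K. \<exists>B. \<forall>c. \<bar>c l\<bar> \<le> B * norm (\<Sum>k\<in>K. c k *\<^sub>R a k)"
  proof
    fix l assume l: "l \<in> K"
    obtain \<phi> :: "'v \<Rightarrow> real" where lin: "linear \<phi>" and \<phi>: "\<And>c. \<phi> (\<Sum>k\<in>K. c k *\<^sub>R a k) = c l"
      using independent_family_functional[OF K l indep] by blast
    obtain B where "\<And>x. norm (\<phi> x) \<le> B * norm x"
      using linear_bounded[OF lin] by blast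
    then show "\<exists>B. \<forall>c. \<bar>c l\<bar> \<le> B * norm (\<Sum>k\<in>K. c k *\<^sub>R a k)"
      by (metis \<phi> real_norm_def)
  qed
  then obtain B where B: "\<And>l c. l \<in> K \<Longrightarrow> \<bar>c l\<bar> \<le> B l * norm (\<Sum>k\<in>K. c k *\<^sub>R a k)"
    by metis
  define S where "S = (\<Sum>l\<in>K. \<bar>B l\<bar>) + 1"
  have S: "S > 0" unfolding S_def by (simp add: add_nonneg_pos sum_nonneg)
  have bound: "(\<Sum>k\<in>K. \<bar>c k\<bar>) \<le> S * norm (\<Sum>k\<in>K. c k *\<^sub>R a k)" for c
  proof -
    have "(\<Sum>l\<in>K. \<bar>c l\<bar>) \<le> (\<Sum>l\<in>K. \<bar>B l\<bar> * norm (\<Sum>k\<in>K. c k *\<^sub>R a k))"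
      by (intro sum_mono order_trans[OF B] mult_right_mono) auto
    also have "\<dots> = (\<Sum>l\<in>K. \<bar>B l\<bar>) * norm (\<Sum>k\<in>K. c k *\<^sub>R a k)"
      by (simp add: sum_distrib_right)
    also have "\<dots> \<le> S * norm (\<Sum>k\<in>K. c k *\<^sub>R a k)"
      by (intro mult_right_mono) (auto simp: S_def)
    finally show ?thesis .
  qed
  have absorb: "s \<le> 2 * S * v" if "s \<le> S * w" "w \<le> v + s * (1 / (2 * S))" for s v w
  proof -
    have "S * w \<le> S * (v + s * (1 / (2 * S)))" using that(2) S by (intro mult_left_mono) auto
    also have "\<dots> = S * v + s / 2" using S by (simp add: field_simps)
    finally show ?thesis using that(1) by simp
  qed
  have "\<forall>\<^sub>F n in F. \<forall>k\<in>K. dist (A k n) (a k) < 1 / (2 * S)"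
    using K lim S by (intro eventually_ball_finite ballI tendstoD) auto
  then have "\<forall>\<^sub>F n in F. \<forall>c. (\<Sum>k\<in>K. \<bar>c k\<bar>) \<le> 2 * S * norm (\<Sum>k\<in>K. c k *\<^sub>R A k n)"
  proof (rule eventually_mono, intro allI)
    fix n c assume near: "\<forall>k\<in>K. dist (A k n) (a k) < 1 / (2 * S)"
    let ?s = "\<Sum>k\<in>K. \<bar>c k\<bar>" and ?v = "\<Sum>k\<in>K. c k *\<^sub>R A k n"
    have eq: "(\<Sum>k\<in>K. c k *\<^sub>R a k) = ?v - (\<Sum>k\<in>K. c k *\<^sub>R (A k n - a k))"
      by (simp add: scaleR_diff_right sum_subtractf)
    have "norm (c k *\<^sub>R (A k n - a k)) \<le> \<bar>c k\<bar> * (1 / (2 * S))" if "k \<in> K" for k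
      unfolding norm_scaleR using near that
      by (intro mult_left_mono) (auto simp: dist_norm intro: less_imp_le)
    then have "norm (\<Sum>k\<in>K. c k *\<^sub>R (A k n - a k)) \<le> (\<Sum>k\<in>K. \<bar>c k\<bar> * (1 / (2 * S)))"
      by (rule sum_norm_le)
    then have diff: "norm (\<Sum>k\<in>K. c k *\<^sub>R (A k n - a k)) \<le> ?s * (1 / (2 * S))"
      unfolding sum_distrib_right .
    have "norm (\<Sum>k\<in>K. c k *\<^sub>R a k) \<le> norm ?v + ?s * (1 / (2 * S))"
      unfolding eq by (rule order_trans[OF norm_triangle_ineq4 add_left_mono[OF diff]])
    with bound[of c] show "?s \<le> 2 * S * norm ?v" by (rule absorb)
  qed
  then show thesis by (rule that[rotated]) (use S in simp)
qed

section \<open>Isolated stationary points\<close>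

lemma has_derivative_sequential_quotient:
  fixes f :: "'v::euclidean_space \<Rightarrow> 'w::real_normed_vector"
  assumes f: "(f has_derivative f') (at x)"
    and y: "y \<longlonglongrightarrow> x" "\<And>n. y n \<noteq> x"
    and l: "(\<lambda>n. (y n - x) /\<^sub>R norm (y n - x)) \<longlonglongrightarrow> l"
  shows "(\<lambda>n. (f (y n) - f x) /\<^sub>R norm (y n - x)) \<longlonglongrightarrow> f' l"
proof -
  have bl: "bounded_linear f'" using f by (rule has_derivative_bounded_linear)
  have "((\<lambda>z. (f z - f x - f' (z - x)) /\<^sub>R norm (z - x)) \<longlongrightarrow> 0) (at x)"
    using f unfolding has_derivative_within inverse_eq_divide diff_diff_eq by blast
  moreover have "filterlim y (at x) sequentially"
    using y by (simp add: filterlim_at)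
  ultimately have 1: "(\<lambda>n. (f (y n) - f x - f' (y n - x)) /\<^sub>R norm (y n - x)) \<longlonglongrightarrow> 0"
    by (rule filterlim_compose)
  have 2: "(\<lambda>n. f' ((y n - x) /\<^sub>R norm (y n - x))) \<longlonglongrightarrow> f' l"
    by (rule bounded_linear.tendsto[OF bl l])
  have eq: "(f (y n) - f x - f' (y n - x)) /\<^sub>R norm (y n - x) +
      f' ((y n - x) /\<^sub>R norm (y n - x)) = (f (y n) - f x) /\<^sub>R norm (y n - x)" for n
    unfolding linear_cmul[OF bounded_linear.linear[OF bl]] scaleR_add_right[symmetric] diff_add_cancel
    by (rule refl)
  have "(\<lambda>n. (f (y n) - f x) /\<^sub>R norm (y n - x)) \<longlonglongrightarrow> 0 + f' l"
    using tendsto_add[OF 1 2] unfolding eq .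
  then show ?thesis by (rule subst[OF add_0_left])
qed

text \<open>
  The compactness argument above in abstract form: \<open>F\<close> is the pseudogradient of the objectives,
  \<open>h k\<close> are the active constraints and \<open>a k\<close> their gradients, \<open>\<mu>\<close> are the multipliers at \<open>xb\<close>.  The
  last assumption is nondegeneracy of the bilinear form of \<open>D\<close> on the tangent space.
\<close>

lemma nondegenerate_stationary_point_isolated:
  fixes a :: "'c \<Rightarrow> 'v::euclidean_space \<Rightarrow> 'v" and h :: "'c \<Rightarrow> 'v \<Rightarrow> real"
  assumes K: "finite K"
    and a: "\<And>k. k \<in> K \<Longrightarrow> isCont (a k) xb"
    and h: "\<And>k. k \<in> K \<Longrightarrow> (h k has_derivative (\<lambda>v. a k xb \<bullet> v)) (at xb)"
    and h0: "\<And>k. k \<in> K \<Longrightarrow> h k xb = 0"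
    and indep: "\<And>c. (\<Sum>k\<in>K. c k *\<^sub>R a k xb) = 0 \<Longrightarrow> \<forall>k\<in>K. c k = 0"
    and stat: "F xb = (\<Sum>k\<in>K. \<mu> k *\<^sub>R a k xb)"
    and pos: "\<And>k. k \<in> K \<Longrightarrow> \<mu> k > 0"
    and D: "((\<lambda>x. F x - (\<Sum>k\<in>K. \<mu> k *\<^sub>R a k x)) has_derivative D) (at xb)"
    and nonsing: "\<And>\<xi>. (\<forall>k\<in>K. a k xb \<bullet> \<xi> = 0) \<Longrightarrow>
        (\<And>v. (\<forall>k\<in>K. a k xb \<bullet> v = 0) \<Longrightarrow> v \<bullet> D \<xi> = 0) \<Longrightarrow> \<xi> = 0"
  shows "\<forall>\<^sub>F x in at xb. \<not> (\<exists>c. F x = (\<Sum>k\<in>K. c k *\<^sub>R a k x) \<and> (\<forall>k\<in>K. c k * h k x = 0))"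
    (is "\<forall>\<^sub>F x in at xb. \<not> ?Q x")
proof (rule ccontr)
  define R where "R = (\<lambda>x. F x - (\<Sum>k\<in>K. \<mu> k *\<^sub>R a k x))"
  have R0: "R xb = 0" using stat by (simp add: R_def)
  assume "\<not> ?thesis"
  then have "\<exists>x. x \<noteq> xb \<and> dist x xb < inverse (real (Suc n)) \<and> ?Q x" for n
    unfolding eventually_at by (metis UNIV_I inverse_positive_iff_positive of_nat_0_less_iff zero_less_Suc)
  then obtain x c where x: "\<And>n. x n \<noteq> xb" "\<And>n. dist (x n) xb < inverse (real (Suc n))"
      and "\<And>n. F (x n) = (\<Sum>k\<in>K. c n k *\<^sub>R a k (x n)) \<and> (\<forall>k\<in>K. c n k * h k (x n) = 0)"
    by metis
  then have c: "\<And>n. F (x n) = (\<Sum>k\<in>K. c n k *\<^sub>R a k (x n))"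
      "\<And>n k. k \<in> K \<Longrightarrow> c n k * h k (x n) = 0"
    by auto
  have xlim: "x \<longlonglongrightarrow> xb"
  proof (rule metric_tendsto_imp_tendsto[OF LIMSEQ_inverse_real_of_nat])
    show "\<forall>\<^sub>F n in sequentially. dist (x n) xb \<le> dist (inverse (real (Suc n))) 0"
      using x(2) by (auto simp: less_imp_le)
  qed
  have "\<forall>n. (x n - xb) /\<^sub>R norm (x n - xb) \<in> sphere 0 1"
    using x(1) by simp
  then obtain l s where l: "l \<in> sphere 0 1" and s: "strict_mono (s :: nat \<Rightarrow> nat)"
      and "((\<lambda>n. (x n - xb) /\<^sub>R norm (x n - xb)) \<circ> s) \<longlonglongrightarrow> l"
    by (rule seq_compactE[OF compact_imp_seq_compact[OF compact_sphere]])
  define y where "y = x \<circ> s"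
  define t where "t n = norm (y n - xb)" for n
  \<comment> \<open>multiplier increments per unit of distance to \<open>xb\<close>; they stay bounded by independence\<close>
  define d where "d n k = (c (s n) k - \<mu> k) / t n" for n k
  have y: "y \<longlonglongrightarrow> xb" "\<And>n. y n \<noteq> xb" and yl: "(\<lambda>n. (y n - xb) /\<^sub>R norm (y n - xb)) \<longlonglongrightarrow> l"
    using xlim x(1) s \<open>_ \<longlonglongrightarrow> l\<close> by (auto simp: y_def o_def intro: LIMSEQ_subseq_LIMSEQ[unfolded o_def])
  have t: "t n > 0" for n using y(2) by (simp add: t_def)
  have tlim: "t \<longlonglongrightarrow> 0" unfolding t_def using y(1) by (simp add: LIM_zero tendsto_norm_zero)
  have alim: "(\<lambda>n. a k (y n)) \<longlonglongrightarrow> a k xb" if "k \<in> K" for k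
    using a[OF that] y(1) by (rule isCont_tendsto_compose)
  have Rlim: "(\<lambda>n. R (y n) /\<^sub>R t n) \<longlonglongrightarrow> D l"
    using has_derivative_sequential_quotient[OF D y yl] R0 by (simp add: R_def t_def)
  have Rd: "R (y n) /\<^sub>R t n = (\<Sum>k\<in>K. d n k *\<^sub>R a k (y n))" for n
    using c(1)[of "s n"]
    by (simp add: R_def y_def d_def scaleR_sum_right scaleR_diff_left scaleR_diff_right
        sum_subtractf divide_inverse_commute right_diff_distrib)
  obtain C where C: "C > 0"
      "\<forall>\<^sub>F n in sequentially. \<forall>c. (\<Sum>k\<in>K. \<bar>c k\<bar>) \<le> C * norm (\<Sum>k\<in>K. c k *\<^sub>R a k (y n))"
    using independent_family_coeffs_bounded[where A = "\<lambda>k n. a k (y n)" and F = sequentially,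
        OF K indep alim] by blast
  obtain B where B: "\<And>n. norm (R (y n) /\<^sub>R t n) \<le> B"
    using BseqE[OF convergent_imp_Bseq[OF convergentI[OF Rlim]]] by blast
  have dB: "\<forall>\<^sub>F n in sequentially. \<forall>k\<in>K. \<bar>d n k\<bar> \<le> C * B"
    using C(2)
  proof eventually_elim
    case (elim n)
    have "\<bar>d n k\<bar> \<le> C * B" if "k \<in> K" for k
    proof -
      have "\<bar>d n k\<bar> \<le> (\<Sum>k\<in>K. \<bar>d n k\<bar>)" using K that by (intro member_le_sum) auto
      also have "\<dots> \<le> C * norm (R (y n) /\<^sub>R t n)" unfolding Rd using elim by blast
      also have "\<dots> \<le> C * B" using B C(1) by (intro mult_left_mono) auto
      finally show ?thesis .
    qed
    then show ?case by blast
  qed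
  have dlim: "(\<lambda>n. d n k * z n) \<longlonglongrightarrow> 0" if "k \<in> K" "z \<longlonglongrightarrow> 0" for k z
  proof (rule Lim_null_comparison)
    show "\<forall>\<^sub>F n in sequentially. norm (d n k * z n) \<le> C * B * \<bar>z n\<bar>"
      using dB by eventually_elim (use that in \<open>auto simp: abs_mult intro!: mult_right_mono\<close>)
    show "(\<lambda>n. C * B * \<bar>z n\<bar>) \<longlonglongrightarrow> 0"
      using that(2) by (auto intro!: tendsto_eq_intros)
  qed
  have tangent: "\<forall>k\<in>K. a k xb \<bullet> l = 0"
  proof
    fix k assume k: "k \<in> K"
    have "(\<lambda>n. \<mu> k + d n k * t n) \<longlonglongrightarrow> \<mu> k + 0"
      by (intro tendsto_intros dlim k tlim)
    then have "\<forall>\<^sub>F n in sequentially. \<mu> k + d n k * t n > 0"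
      using pos[OF k] by (intro order_tendstoD) auto
    \<comment> \<open>a positive multiplier forces its constraint to be active\<close>
    then have "\<forall>\<^sub>F n in sequentially. (h k (y n) - h k xb) /\<^sub>R norm (y n - xb) = 0"
    proof eventually_elim
      case (elim n)
      have "\<mu> k + d n k * t n = c (s n) k" using t[of n] by (simp add: d_def)
      then have "h k (y n) = 0" using elim c(2)[OF k, of "s n"] by (simp add: y_def)
      then show ?case using h0[OF k] by simp
    qed
    then have "(\<lambda>n. (h k (y n) - h k xb) /\<^sub>R norm (y n - xb)) \<longlonglongrightarrow> 0"
      by (rule tendsto_eventually)
    moreover have "(\<lambda>n. (h k (y n) - h k xb) /\<^sub>R norm (y n - xb)) \<longlonglongrightarrow> a k xb \<bullet> l"
      by (rule has_derivative_sequential_quotient[OF h[OF k] y yl])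
    ultimately show "a k xb \<bullet> l = 0" using LIMSEQ_unique by blast
  qed
  have "v \<bullet> D l = 0" if v: "\<forall>k\<in>K. a k xb \<bullet> v = 0" for v
  proof -
    have "(\<lambda>n. v \<bullet> a k (y n)) \<longlonglongrightarrow> 0" if "k \<in> K" for k
      using tendsto_inner[OF tendsto_const[of v] alim[OF that]] v that
      by (simp add: inner_commute)
    then have "(\<lambda>n. \<Sum>k\<in>K. d n k * (v \<bullet> a k (y n))) \<longlonglongrightarrow> 0"
      by (intro tendsto_null_sum dlim)
    then have "(\<lambda>n. v \<bullet> (R (y n) /\<^sub>R t n)) \<longlonglongrightarrow> 0"
      by (simp add: Rd inner_sum_right)
    moreover have "(\<lambda>n. v \<bullet> (R (y n) /\<^sub>R t n)) \<longlonglongrightarrow> v \<bullet> D l"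
      by (intro tendsto_intros Rlim)
    ultimately show ?thesis using LIMSEQ_unique by blast
  qed
  with nonsing tangent have "l = 0" by blast
  with l show False by simp
qed

section \<open>Nonsingularity on the tangent space\<close>

text \<open>
  Basis-free form of (ND3).  If \<open>M \<xi>\<close> is orthogonal to \<open>T\<close>, then the coordinates of \<open>\<xi>\<close> with respect to
  the basis lie in the kernel of the restricted matrix.
\<close>

lemma restricted_matrix_invertible_imp_nonsingular:
  fixes M :: "real^'i^'i::finite"
  assumes basis: "is_basis_of vs T"
    and inv: "invertible_mat (restricted_matrix vs M)"
    and \<xi>: "\<xi> \<in> T" and orth: "\<And>v. v \<in> T \<Longrightarrow> v \<bullet> (M *v \<xi>) = 0"
  shows "\<xi> = 0"
proof -
  let ?n = "length vs" and ?A = "restricted_matrix vs M"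
  have T: "span (set vs) = T" and dist: "distinct vs"
    using basis by (auto simp: is_basis_of_def)
  obtain u where "\<xi> = (\<Sum>v\<in>set vs. u v *\<^sub>R v)"
    using \<xi> T span_finite[of "set vs"] by auto
  also have "\<dots> = (\<Sum>b<?n. u (vs ! b) *\<^sub>R vs ! b)"
    using sum.reindex_bij_betw[OF bij_betw_nth[OF dist refl refl], symmetric] .
  finally have exp: "\<xi> = (\<Sum>b<?n. u (vs ! b) *\<^sub>R vs ! b)" .
  define w where "w = Matrix.vec ?n (\<lambda>b. u (vs ! b))"
  have Ac: "?A \<in> carrier_mat ?n ?n" by (simp add: restricted_matrix_def)
  have wc: "w \<in> carrier_vec ?n" by (simp add: w_def)
  have Aw: "?A *\<^sub>v w = 0\<^sub>v ?n"
  proof (rule eq_vecI)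
    show "dim_vec (?A *\<^sub>v w) = dim_vec (0\<^sub>v ?n :: real Matrix.vec)" using Ac by simp
    fix i assume "i < dim_vec (0\<^sub>v ?n :: real Matrix.vec)"
    then have i: "i < ?n" by simp
    have "vs ! i \<in> T" using i T span_base nth_mem by metis
    have "vec_index (?A *\<^sub>v w) i = (\<Sum>b<?n. vs ! i \<bullet> (M *v vs ! b) * u (vs ! b))"
      using i by (auto simp: restricted_matrix_def w_def mult_mat_vec_def scalar_prod_def
          atLeast0LessThan intro!: sum.cong)
    also have "\<dots> = vs ! i \<bullet> (M *v \<xi>)"
      unfolding exp
      by (simp add: linear_sum[OF matrix_vector_mul_linear] matrix_vector_mult_scaleR
          inner_sum_right mult.commute)
    also have "\<dots> = 0" by (rule orth) fact
    finally show "vec_index (?A *\<^sub>v w) i = vec_index (0\<^sub>v ?n) i" using i by simp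
  qed
  obtain B where B: "B * ?A = 1\<^sub>m (dim_row B)" "?A * B = 1\<^sub>m ?n"
    using inv Ac unfolding invertible_mat_def inverts_mat_def by auto
  have Bc: "B \<in> carrier_mat ?n ?n"
    using arg_cong[OF B(1), of dim_col] arg_cong[OF B(2), of dim_col] Ac by auto
  have "w = (B * ?A) *\<^sub>v w" using B(1) Bc wc by simp
  also have "\<dots> = B *\<^sub>v (0\<^sub>v ?n)" using assoc_mult_mat_vec[OF Bc Ac wc] Aw by simp
  finally have "w = 0\<^sub>v ?n" using Bc by auto
  then have "u (vs ! b) = 0" if "b < ?n" for b
    using that unfolding w_def by (metis index_vec index_zero_vec(1))
  then show ?thesis unfolding exp by simp
qed

section \<open>Gradients and partial gradients\<close>

lemma has_derivative_grad:
  fixes h :: "real^'i::finite \<Rightarrow> real"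
  assumes "h differentiable (at x)"
  shows "(h has_derivative (\<lambda>v. grad h x \<bullet> v)) (at x)"
proof -
  have der: "(h has_derivative frechet_derivative h (at x)) (at x)"
    using assms frechet_derivative_works by blast
  then have lin: "linear (frechet_derivative h (at x))"
    by (rule has_derivative_linear)
  have "frechet_derivative h (at x) v = grad h x \<bullet> v" for v
  proof -
    have "frechet_derivative h (at x) v = frechet_derivative h (at x) (\<Sum>i\<in>UNIV. v $ i *s axis i 1)"
      by (simp add: basis_expansion)
    also have "\<dots> = grad h x \<bullet> v"
      by (simp add: linear_sum[OF lin] linear_cmul[OF lin] scalar_mult_eq_scaleR inner_vec_def
          grad_def mult.commute)
    finally show ?thesis .
  qed
  then have "frechet_derivative h (at x) = (\<lambda>v. grad h x \<bullet> v)" by blast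
  with der show ?thesis by simp
qed

lemma grad_eqI:
  fixes h :: "real^'i::finite \<Rightarrow> real"
  assumes "(h has_derivative (\<lambda>v. g \<bullet> v)) (at x)"
  shows "grad h x = g"
  unfolding grad_def frechet_derivative_at[OF assms, symmetric]
  by (simp add: Finite_Cartesian_Product.vec_eq_iff inner_axis)

text \<open>
  Along the coordinate directions of the other players the function is constant.  Hence the padded
  partial gradient really is the derivative of an individual constraint on the whole space.
\<close>

lemma pgrad_eq_grad_if_depends_only_on:
  fixes P :: "('i::finite, 'p, 'j, 'k) gnep"
  assumes dep: "depends_only_on (owner P) \<nu> h" and diff: "h differentiable (at x)"
  shows "pgrad P \<nu> h x = grad h x"
proof -
  have "grad h x $ i = 0" if i: "owner P i \<noteq> \<nu>" for i
  proof -
    have "((\<lambda>t::real. x + t *\<^sub>R axis i 1) has_derivative (\<lambda>t. t *\<^sub>R axis i 1)) (at 0)"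
      by (auto intro!: derivative_eq_intros)
    moreover have "(h has_derivative (\<lambda>v. grad h x \<bullet> v)) (at (x + 0 *\<^sub>R axis i (1::real)))"
      using has_derivative_grad[OF diff] by simp
    ultimately have "((\<lambda>t. h (x + t *\<^sub>R axis i 1)) has_derivative
        (\<lambda>t. grad h x \<bullet> (t *\<^sub>R axis i 1))) (at 0)"
      by (rule has_derivative_compose)
    moreover have "h (x + t *\<^sub>R axis i 1) = h x" for t
      using dep i unfolding depends_only_on_def by (auto simp: axis_def)
    ultimately have "((\<lambda>t. h x) has_derivative (\<lambda>t. t * grad h x $ i)) (at (0::real))"
      by (simp add: inner_axis)
    from has_derivative_unique[OF this has_derivative_const]
    have "\<And>t. t * grad h x $ i = 0" by metis
    from this[of 1] show ?thesis by simp
  qed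
  then show ?thesis by (simp add: pgrad_def Finite_Cartesian_Product.vec_eq_iff)
qed

lemma differentiable_vec_componentwise:
  fixes f :: "'v::real_normed_vector \<Rightarrow> real^'i::finite"
  assumes "\<And>i. (\<lambda>y. f y $ i) differentiable (at x)"
  shows "f differentiable (at x)"
proof -
  obtain f' where f': "\<And>i. ((\<lambda>y. f y $ i) has_derivative f' i) (at x)"
    using assms unfolding differentiable_def by metis
  have "((\<lambda>y. \<Sum>i\<in>UNIV. (f y $ i) *\<^sub>R axis i (1::real)) has_derivative
      (\<lambda>v. \<Sum>i\<in>UNIV. f' i v *\<^sub>R axis i 1)) (at x)"
    by (intro derivative_intros has_derivative_scaleR_left f')
  moreover have "(\<Sum>i\<in>UNIV. (f y $ i) *\<^sub>R axis i (1::real)) = f y" for y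
    using basis_expansion[of "f y"] by (simp add: scalar_mult_eq_scaleR)
  ultimately show ?thesis by (auto simp: differentiable_def)
qed

lemma pgrad_differentiable:
  fixes P :: "('i::finite, 'p, 'j, 'k) gnep"
  assumes "C2_fun h"
  shows "pgrad P \<nu> h differentiable (at x)"
proof (rule differentiable_vec_componentwise)
  fix i
  have "grad h differentiable (at x)" using assms by (simp add: C2_fun_def)
  then have "(\<lambda>y. grad h y $ i) differentiable (at x)"
    by (auto simp: differentiable_def
        intro: bounded_linear.has_derivative[OF bounded_linear_vec_nth])
  then show "(\<lambda>y. pgrad P \<nu> h y $ i) differentiable (at x)"
    by (cases "owner P i = \<nu>") (simp_all add: pgrad_def)
qed

section \<open>Stacking the conditions of all players\<close>

text \<open>
  Individual and shared constraints are indexed together, by \<open>Inl (\<nu>, j)\<close> and \<open>Inr j\<close>, so that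
  all multipliers form a single family.
\<close>

definition con :: "('i::finite, 'p, 'j, 'k) gnep \<Rightarrow> ('p \<times> 'k) + 'j \<Rightarrow> real^'i \<Rightarrow> real" where
  "con P = case_sum (\<lambda>(\<nu>, j). gcon P \<nu> j) (Gcon P)"

definition con_grad :: "('i::finite, 'p, 'j, 'k) gnep \<Rightarrow> ('p \<times> 'k) + 'j \<Rightarrow> real^'i \<Rightarrow> real^'i" where
  "con_grad P = case_sum (\<lambda>(\<nu>, j). pgrad P \<nu> (gcon P \<nu> j)) (\<lambda>j. grad (Gcon P j))"

definition obj_pseudograd ::
  "('i::finite, 'p::finite, 'j, 'k) gnep \<Rightarrow> ('p \<Rightarrow> real) \<Rightarrow> real^'i \<Rightarrow> real^'i" where
  "obj_pseudograd P r x = (\<Sum>\<nu>\<in>UNIV. r \<nu> *\<^sub>R pgrad P \<nu> (obj P \<nu>) x)"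

definition active :: "('i::finite, 'p::finite, 'j, 'k) gnep \<Rightarrow> real^'i \<Rightarrow> (('p \<times> 'k) + 'j) set" where
  "active P x = Sigma UNIV (\<lambda>\<nu>. active_indiv P \<nu> x) <+> active_shared P x"

lemma sum_eq_single_term:
  fixes \<mu> :: "'p::finite"
  assumes "\<And>\<nu>. \<nu> \<noteq> \<mu> \<Longrightarrow> f \<nu> = 0"
  shows "(\<Sum>\<nu>\<in>UNIV. f \<nu>) = (f \<mu> :: real)"
  using assms sum.mono_neutral_right[of UNIV "{\<mu>}" f] by auto

lemma obj_pseudograd_nth:
  "obj_pseudograd P r x $ i = r (owner P i) * grad (obj P (owner P i)) x $ i"
  unfolding obj_pseudograd_def sum_component
  by (subst sum_eq_single_term[of "owner P i"]) (auto simp: pgrad_def)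

lemma con_grad_sum_nth:
  fixes P :: "('i::finite, 'p::finite, 'j, 'k) gnep"
  assumes A: "\<And>\<nu>. finite (A \<nu>)" and B: "finite B"
  shows "(\<Sum>k\<in>Sigma UNIV A <+> B. c k *\<^sub>R con_grad P k x) $ i =
    (\<Sum>j\<in>A (owner P i). c (Inl (owner P i, j)) * grad (gcon P (owner P i) j) x $ i) +
    (\<Sum>j\<in>B. c (Inr j) * grad (Gcon P j) x $ i)"
proof -
  have "(\<Sum>k\<in>Sigma UNIV A <+> B. c k *\<^sub>R con_grad P k x) $ i =
     (\<Sum>\<nu>\<in>UNIV. \<Sum>j\<in>A \<nu>. c (Inl (\<nu>, j)) * pgrad P \<nu> (gcon P \<nu> j) x $ i) +
     (\<Sum>j\<in>B. c (Inr j) * grad (Gcon P j) x $ i)"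
    using A B by (simp add: sum.Plus sum.Sigma finite_SigmaI con_grad_def split_def)
  also have "(\<Sum>\<nu>\<in>UNIV. \<Sum>j\<in>A \<nu>. c (Inl (\<nu>, j)) * pgrad P \<nu> (gcon P \<nu> j) x $ i) =
     (\<Sum>j\<in>A (owner P i). c (Inl (owner P i, j)) * grad (gcon P (owner P i) j) x $ i)"
    by (subst sum_eq_single_term[of "owner P i"]) (auto simp: pgrad_def)
  finally show ?thesis .
qed

text \<open>
  Every coordinate belongs to one player, so coordinate \<open>i\<close> of the stacked equation is coordinate \<open>i\<close>
  of the equation of its owner; the remaining coordinates of a player's equation read \<open>0 = 0\<close>.
\<close>

lemma players_stationary_iff_stacked:
  fixes P :: "('i::finite, 'p::finite, 'j, 'k) gnep"
  assumes A: "\<And>\<nu>. finite (A \<nu>)" and B: "finite B"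
  shows "(\<forall>\<nu>. r \<nu> *\<^sub>R pgrad P \<nu> (obj P \<nu>) x =
        (\<Sum>j\<in>A \<nu>. c (Inl (\<nu>, j)) *\<^sub>R pgrad P \<nu> (gcon P \<nu> j) x) +
        (\<Sum>j\<in>B. c (Inr j) *\<^sub>R pgrad P \<nu> (Gcon P j) x)) \<longleftrightarrow>
    obj_pseudograd P r x = (\<Sum>k\<in>Sigma UNIV A <+> B. c k *\<^sub>R con_grad P k x)"
    (is "?L \<longleftrightarrow> ?R")
proof -
  have "?L \<longleftrightarrow> (\<forall>i. r (owner P i) * grad (obj P (owner P i)) x $ i =
     (\<Sum>j\<in>A (owner P i). c (Inl (owner P i, j)) * grad (gcon P (owner P i) j) x $ i) +
     (\<Sum>j\<in>B. c (Inr j) * grad (Gcon P j) x $ i))" (is "_ \<longleftrightarrow> (\<forall>i. ?E i)")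
  proof
    assume ?L
    show "\<forall>i. ?E i"
    proof
      fix i
      from \<open>?L\<close>[rule_format, of "owner P i", THEN arg_cong, of "\<lambda>v. v $ i"]
      show "?E i" by (simp add: pgrad_def)
    qed
  next
    assume "\<forall>i. ?E i"
    then have eq: "?E i" for i by blast
    show ?L
    proof (intro allI Finite_Cartesian_Product.vec_eq_iff[THEN iffD2])
      fix \<nu> i
      show "(r \<nu> *\<^sub>R pgrad P \<nu> (obj P \<nu>) x) $ i =
          ((\<Sum>j\<in>A \<nu>. c (Inl (\<nu>, j)) *\<^sub>R pgrad P \<nu> (gcon P \<nu> j) x) +
           (\<Sum>j\<in>B. c (Inr j) *\<^sub>R pgrad P \<nu> (Gcon P j) x)) $ i"
        using eq[of i] by (cases "owner P i = \<nu>") (auto simp: pgrad_def)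
    qed
  qed
  also have "\<dots> \<longleftrightarrow> ?R"
    unfolding Finite_Cartesian_Product.vec_eq_iff obj_pseudograd_nth con_grad_sum_nth[OF A B] by (rule refl)
  finally show ?thesis .
qed

lemma GNEP_finite_active:
  assumes "GNEP P"
  shows "finite (active_indiv P \<nu> x)" "finite (active_shared P x)" "finite (active P x)"
  using assms by (auto simp: GNEP_def active_indiv_def active_shared_def active_def)

lemma ball_active_iff:
  "(\<forall>k\<in>active P x. Q k) \<longleftrightarrow>
     (\<forall>\<nu>. \<forall>j\<in>active_indiv P \<nu> x. Q (Inl (\<nu>, j))) \<and> (\<forall>j\<in>active_shared P x. Q (Inr j))"
  unfolding active_def by (auto simp: Plus_def)

lemma active_con_derivative:
  assumes P: "GNEP P" and k: "k \<in> active P x"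
  shows "(con P k has_derivative (\<lambda>v. con_grad P k y \<bullet> v)) (at y)"
    and "con_grad P k differentiable (at y)"
    and "con P k x = 0"
proof -
  show "(con P k has_derivative (\<lambda>v. con_grad P k y \<bullet> v)) (at y)"
  proof (cases k)
    case (Inl p)
    obtain \<nu> j where p: "p = (\<nu>, j)" by (cases p)
    have "C2_fun (gcon P \<nu> j)" "depends_only_on (owner P) \<nu> (gcon P \<nu> j)"
      using P k Inl p by (auto simp: GNEP_def active_def active_indiv_def)
    then show ?thesis
      using has_derivative_grad[of "gcon P \<nu> j" y] pgrad_eq_grad_if_depends_only_on[of P \<nu> "gcon P \<nu> j" y]
      by (simp add: Inl p con_def con_grad_def C2_fun_def)
  next
    case (Inr j)
    have "C2_fun (Gcon P j)"
      using P k Inr by (auto simp: GNEP_def active_def active_shared_def)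
    then show ?thesis
      using has_derivative_grad[of "Gcon P j" y] by (simp add: Inr con_def con_grad_def C2_fun_def)
  qed
  show "con_grad P k differentiable (at y)"
  proof (cases k)
    case (Inl p)
    then show ?thesis
      using P k by (cases p) (auto simp: con_grad_def GNEP_def active_def active_indiv_def
          intro!: pgrad_differentiable)
  next
    case (Inr j)
    then show ?thesis
      using P k by (auto simp: con_grad_def GNEP_def active_def active_shared_def C2_fun_def)
  qed
  show "con P k x = 0"
    using k by (auto simp: active_def active_indiv_def active_shared_def con_def)
qed

lemma pseudogradient_eq_stacked:
  fixes P :: "('i::finite, 'p::finite, 'j, 'k) gnep"
  assumes P: "GNEP P"
  shows "pseudogradient P xb lam Lam r x = obj_pseudograd P r x -
    (\<Sum>k\<in>active P xb. case_sum (\<lambda>(\<nu>, j). lam \<nu> j) Lam k *\<^sub>R con_grad P k x)"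
proof -
  have "grad (lagrangian P xb \<nu> lam Lam r) x = r \<nu> *\<^sub>R grad (obj P \<nu>) x -
     (\<Sum>j\<in>active_indiv P \<nu> xb. lam \<nu> j *\<^sub>R grad (gcon P \<nu> j) x) -
     (\<Sum>j\<in>active_shared P xb. Lam j *\<^sub>R grad (Gcon P j) x)" for \<nu>
  proof (rule grad_eqI)
    have "(obj P \<nu> has_derivative (\<lambda>v. grad (obj P \<nu>) x \<bullet> v)) (at x)"
      using P by (intro has_derivative_grad) (auto simp: GNEP_def C2_fun_def)
    moreover have "(gcon P \<nu> j has_derivative (\<lambda>v. grad (gcon P \<nu> j) x \<bullet> v)) (at x)"
      if "j \<in> active_indiv P \<nu> xb" for j
      using P that by (intro has_derivative_grad) (auto simp: GNEP_def C2_fun_def active_indiv_def)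
    moreover have "(Gcon P j has_derivative (\<lambda>v. grad (Gcon P j) x \<bullet> v)) (at x)"
      if "j \<in> active_shared P xb" for j
      using P that by (intro has_derivative_grad) (auto simp: GNEP_def C2_fun_def active_shared_def)
    ultimately have "((\<lambda>x. lagrangian P xb \<nu> lam Lam r x) has_derivative
      (\<lambda>v. r \<nu> * (grad (obj P \<nu>) x \<bullet> v) - (\<Sum>j\<in>active_indiv P \<nu> xb. lam \<nu> j * (grad (gcon P \<nu> j) x \<bullet> v))
         - (\<Sum>j\<in>active_shared P xb. Lam j * (grad (Gcon P j) x \<bullet> v)))) (at x)"
      unfolding lagrangian_def
      by (intro has_derivative_diff has_derivative_sum has_derivative_mult_right)
    then show "(lagrangian P xb \<nu> lam Lam r has_derivative (\<lambda>v. (r \<nu> *\<^sub>R grad (obj P \<nu>) x -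
        (\<Sum>j\<in>active_indiv P \<nu> xb. lam \<nu> j *\<^sub>R grad (gcon P \<nu> j) x) -
        (\<Sum>j\<in>active_shared P xb. Lam j *\<^sub>R grad (Gcon P j) x)) \<bullet> v)) (at x)"
      by (simp add: inner_diff_left inner_sum_left)
  qed
  then show ?thesis
    unfolding active_def Finite_Cartesian_Product.vec_eq_iff vector_minus_component obj_pseudograd_nth
      con_grad_sum_nth[OF GNEP_finite_active(1,2)[OF P]]
    by (simp add: pseudogradient_def)
qed

lemma pseudogradient_differentiable:
  fixes P :: "('i::finite, 'p::finite, 'j, 'k) gnep"
  assumes P: "GNEP P"
  shows "pseudogradient P xb lam Lam r differentiable (at x)"
proof -
  have "obj_pseudograd P r differentiable (at x)"
    unfolding obj_pseudograd_def using P
    by (intro differentiable_sum differentiable_scaleR ballI pgrad_differentiable) (auto simp: GNEP_def)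
  moreover have "(\<lambda>x. \<Sum>k\<in>active P xb. case_sum (\<lambda>(\<nu>, j). lam \<nu> j) Lam k *\<^sub>R con_grad P k x)
      differentiable (at x)"
    by (intro differentiable_sum differentiable_scaleR ballI active_con_derivative(2)[OF P]
        GNEP_finite_active(3)[OF P]) auto
  ultimately show ?thesis
    unfolding pseudogradient_eq_stacked[OF P, abs_def] by (rule differentiable_diff)
qed

section \<open>Local uniqueness\<close>

lemma eventually_inactive_positive:
  fixes P :: "('i::finite, 'p::finite, 'j, 'k) gnep"
  assumes P: "GNEP P" and xb: "xb \<in> feasible_set P"
  shows "\<forall>\<^sub>F x in at xb. (\<forall>\<nu>. \<forall>j\<in>Jindiv P \<nu> - active_indiv P \<nu> xb. gcon P \<nu> j x > 0) \<and>
    (\<forall>j\<in>Jshared P - active_shared P xb. Gcon P j x > 0)"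
proof -
  have pos: "\<forall>\<^sub>F x in at xb. h x > 0" if "C2_fun h" "h xb > 0" for h :: "real^'i \<Rightarrow> real"
  proof -
    have "isCont h xb" using that(1) by (auto simp: C2_fun_def differentiable_imp_continuous_within)
    then show ?thesis using that(2) by (auto simp: isCont_def intro: order_tendstoD)
  qed
  have "\<forall>\<^sub>F x in at xb. gcon P \<nu> j x > 0" if "j \<in> Jindiv P \<nu> - active_indiv P \<nu> xb" for \<nu> j
    using P xb that by (intro pos) (auto simp: GNEP_def feasible_set_def active_indiv_def less_le)
  moreover have "\<forall>\<^sub>F x in at xb. Gcon P j x > 0" if "j \<in> Jshared P - active_shared P xb" for j
    using P xb that by (intro pos) (auto simp: GNEP_def feasible_set_def active_shared_def less_le)
  moreover have "finite (Jindiv P \<nu> - active_indiv P \<nu> xb)" "finite (Jshared P - active_shared P xb)" for \<nu>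
    using P by (auto simp: GNEP_def)
  ultimately show ?thesis
    by (intro eventually_conj eventually_all_finite) (auto simp: eventually_ball_finite_distrib)
qed

text \<open>
  Near \<open>xb\<close>, the constraints inactive at \<open>xb\<close> are still positive; complementarity then removes them from
  the condition at \<open>x\<close>, which becomes an equation over the index set of \<open>xb\<close>.
\<close>

lemma KKT_multipliers_imp_stacked:
  fixes P :: "('i::finite, 'p::finite, 'j, 'k) gnep"
  assumes P: "GNEP P" and kkt: "KKT_multipliers P r x lam Lam"
    and inactive: "\<forall>\<nu>. \<forall>j\<in>Jindiv P \<nu> - active_indiv P \<nu> xb. gcon P \<nu> j x > 0"
      "\<forall>j\<in>Jshared P - active_shared P xb. Gcon P j x > 0"
  defines "c \<equiv> case_sum (\<lambda>(\<nu>, j). lam \<nu> j) Lam"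
  shows "obj_pseudograd P r x = (\<Sum>k\<in>active P xb. c k *\<^sub>R con_grad P k x)"
    and "\<forall>k\<in>active P xb. c k * con P k x = 0"
proof -
  have lam0: "lam \<nu> j = 0" if "j \<in> Jindiv P \<nu> - active_indiv P \<nu> xb" for \<nu> j
    using kkt inactive(1)[rule_format, OF that] that by (fastforce simp: KKT_multipliers_def)
  have Lam0: "Lam j = 0" if "j \<in> Jshared P - active_shared P xb" for j
    using kkt inactive(2)[rule_format, OF that] that by (fastforce simp: KKT_multipliers_def)
  have sum_indiv: "(\<Sum>j\<in>Jindiv P \<nu>. lam \<nu> j *\<^sub>R pgrad P \<nu> (gcon P \<nu> j) x) =
      (\<Sum>j\<in>active_indiv P \<nu> xb. lam \<nu> j *\<^sub>R pgrad P \<nu> (gcon P \<nu> j) x)" for \<nu>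
    using P lam0 by (intro sum.mono_neutral_right) (auto simp: GNEP_def active_indiv_def)
  have sum_shared: "(\<Sum>j\<in>Jshared P. Lam j *\<^sub>R pgrad P \<nu> (Gcon P j) x) =
      (\<Sum>j\<in>active_shared P xb. Lam j *\<^sub>R pgrad P \<nu> (Gcon P j) x)" for \<nu>
    using P Lam0 by (intro sum.mono_neutral_right) (auto simp: GNEP_def active_shared_def)
  have "\<forall>\<nu>. r \<nu> *\<^sub>R pgrad P \<nu> (obj P \<nu>) x =
      (\<Sum>j\<in>active_indiv P \<nu> xb. c (Inl (\<nu>, j)) *\<^sub>R pgrad P \<nu> (gcon P \<nu> j) x) +
      (\<Sum>j\<in>active_shared P xb. c (Inr j) *\<^sub>R pgrad P \<nu> (Gcon P j) x)"
    using kkt unfolding KKT_multipliers_def sum_indiv sum_shared by (simp add: c_def)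
  then show "obj_pseudograd P r x = (\<Sum>k\<in>active P xb. c k *\<^sub>R con_grad P k x)"
    unfolding active_def
    by (subst (asm) players_stationary_iff_stacked) (auto intro: GNEP_finite_active[OF P])
  show "\<forall>k\<in>active P xb. c k * con P k x = 0"
    using kkt by (simp add: ball_active_iff KKT_multipliers_def active_indiv_def active_shared_def
        c_def con_def)
qed

lemma GNEP_LICQ_imp_independent:
  fixes P :: "('i::finite, 'p::finite, 'j, 'k) gnep"
  assumes P: "GNEP P" and licq: "GNEP_LICQ P xb"
    and c: "(\<Sum>k\<in>active P xb. c k *\<^sub>R con_grad P k xb) = 0"
  shows "\<forall>k\<in>active P xb. c k = 0"
proof -
  \<comment> \<open>GNEP-LICQ concerns the stationarity system with all objective weights set to zero\<close>
  have "obj_pseudograd P (\<lambda>_. 0) xb = (\<Sum>k\<in>active P xb. c k *\<^sub>R con_grad P k xb)"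
    using c by (simp add: obj_pseudograd_def)
  then have "\<forall>\<nu>. (\<Sum>j\<in>active_indiv P \<nu> xb. c (Inl (\<nu>, j)) *\<^sub>R pgrad P \<nu> (gcon P \<nu> j) xb) +
      (\<Sum>j\<in>active_shared P xb. c (Inr j) *\<^sub>R pgrad P \<nu> (Gcon P j) xb) = 0"
    unfolding active_def
    by (subst (asm) players_stationary_iff_stacked[symmetric]) (auto intro: GNEP_finite_active[OF P])
  from licq[unfolded GNEP_LICQ_def, rule_format, OF this[rule_format]]
  have "\<forall>\<nu>. \<forall>j\<in>active_indiv P \<nu> xb. c (Inl (\<nu>, j)) = 0" "\<forall>j\<in>active_shared P xb. c (Inr j) = 0"
    by blast+
  then show ?thesis by (simp add: ball_active_iff)
qed

lemma nondegenerate_KKT_locally_unique: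
  fixes P :: "('i::finite, 'p::finite, 'j, 'k) gnep"
  assumes P: "GNEP P" and nd: "nondegenerate_KKT P r xb"
  shows "locally_unique (normalized_KKT P r) xb"
proof -
  from nd obtain lam Lam vs where licq: "GNEP_LICQ P xb" and feas: "xb \<in> feasible_set P"
    and kkt: "KKT_multipliers P r xb lam Lam"
    and pos: "\<forall>\<nu>. \<forall>j\<in>active_indiv P \<nu> xb. lam \<nu> j > 0" "\<forall>j\<in>active_shared P xb. Lam j > 0"
    and vs: "is_basis_of vs (tangent_space P xb)"
      "invertible_mat (restricted_matrix vs (jacobian (pseudogradient P xb lam Lam r) (at xb)))"
    unfolding nondegenerate_KKT_def normalized_KKT_def by blast
  let ?\<mu> = "case_sum (\<lambda>(\<nu>, j). lam \<nu> j) Lam"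
  let ?J = "jacobian (pseudogradient P xb lam Lam r) (at xb)"
  have T: "tangent_space P xb = {\<xi>. \<forall>k\<in>active P xb. con_grad P k xb \<bullet> \<xi> = 0}"
    by (simp add: tangent_space_def ball_active_iff con_grad_def)
  have "\<forall>\<^sub>F x in at xb. \<not> (\<exists>c. obj_pseudograd P r x = (\<Sum>k\<in>active P xb. c k *\<^sub>R con_grad P k x) \<and>
      (\<forall>k\<in>active P xb. c k * con P k x = 0))"
  proof (rule nondegenerate_stationary_point_isolated)
    show "finite (active P xb)" by (rule GNEP_finite_active[OF P])
    show "\<forall>k\<in>active P xb. c k = 0" if "(\<Sum>k\<in>active P xb. c k *\<^sub>R con_grad P k xb) = 0" for c
      using P licq that by (rule GNEP_LICQ_imp_independent)
    fix k assume k: "k \<in> active P xb"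
    show "isCont (con_grad P k) xb"
      by (rule differentiable_imp_continuous_within[OF active_con_derivative(2)[OF P k]])
    show "(con P k has_derivative (\<lambda>v. con_grad P k xb \<bullet> v)) (at xb)"
      by (rule active_con_derivative(1)[OF P k])
    show "con P k xb = 0" by (rule active_con_derivative(3)[OF P k])
    show "?\<mu> k > 0" using pos k by (auto simp: active_def)
  next
    show "obj_pseudograd P r xb = (\<Sum>k\<in>active P xb. ?\<mu> k *\<^sub>R con_grad P k xb)"
    proof (rule KKT_multipliers_imp_stacked(1)[OF P kkt])
      show "\<forall>\<nu>. \<forall>j\<in>Jindiv P \<nu> - active_indiv P \<nu> xb. gcon P \<nu> j xb > 0"
        "\<forall>j\<in>Jshared P - active_shared P xb. Gcon P j xb > 0"
        using feas by (auto simp: feasible_set_def active_indiv_def active_shared_def less_le)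
    qed
    show "((\<lambda>x. obj_pseudograd P r x - (\<Sum>k\<in>active P xb. ?\<mu> k *\<^sub>R con_grad P k x))
        has_derivative (\<lambda>v. ?J *v v)) (at xb)"
      using pseudogradient_differentiable[OF P, of xb lam Lam r xb]
      unfolding jacobian_works pseudogradient_eq_stacked[OF P, symmetric] .
    fix \<xi> assume \<xi>: "\<forall>k\<in>active P xb. con_grad P k xb \<bullet> \<xi> = 0"
      and orth: "\<And>v. \<forall>k\<in>active P xb. con_grad P k xb \<bullet> v = 0 \<Longrightarrow> v \<bullet> (?J *v \<xi>) = 0"
    show "\<xi> = 0"
    proof (rule restricted_matrix_invertible_imp_nonsingular[OF vs])
      show "\<xi> \<in> tangent_space P xb" using \<xi> by (simp add: T)
      show "v \<bullet> (?J *v \<xi>) = 0" if "v \<in> tangent_space P xb" for v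
        using that by (intro orth) (simp add: T)
    qed
  qed
  with eventually_inactive_positive[OF P feas]
  have "\<forall>\<^sub>F x in at xb. \<not> normalized_KKT P r x"
  proof eventually_elim
    case (elim x)
    then show ?case
      using KKT_multipliers_imp_stacked[OF P, of r x _ _ xb] unfolding normalized_KKT_def by blast
  qed
  then show ?thesis
    unfolding locally_unique_def eventually_at_topological by blast
qed

text \<open>
  Multiplying the condition of player \<open>\<nu>\<close> by \<open>r \<nu>\<close> makes the multipliers of the shared constraints
  equal for all players.
\<close>

lemma normalized_nash_imp_KKT:
  fixes P :: "('i::finite, 'p, 'j, 'k) gnep"
  assumes r: "\<forall>\<nu>. r \<nu> > 0" and nash: "normalized_nash P r x"
  shows "normalized_KKT P r x"
proof -
  from nash obtain lam Lam where
    stat: "\<And>\<nu>. pgrad P \<nu> (obj P \<nu>) x = (\<Sum>j\<in>Jindiv P \<nu>. lam \<nu> j *\<^sub>R pgrad P \<nu> (gcon P \<nu> j) x) +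
               (\<Sum>j\<in>Jshared P. Lam \<nu> j *\<^sub>R pgrad P \<nu> (Gcon P j) x)" and
    indiv: "\<And>\<nu> j. j \<in> Jindiv P \<nu> \<Longrightarrow>
        lam \<nu> j * gcon P \<nu> j x = 0 \<and> lam \<nu> j \<ge> 0 \<and> gcon P \<nu> j x \<ge> 0" and
    shared: "\<And>\<nu> j. j \<in> Jshared P \<Longrightarrow> Lam \<nu> j * Gcon P j x = 0 \<and> Lam \<nu> j \<ge> 0 \<and> Gcon P j x \<ge> 0" and
    eq: "\<And>\<nu> \<mu> j. j \<in> Jshared P \<Longrightarrow> r \<nu> * Lam \<nu> j = r \<mu> * Lam \<mu> j" and
    feas: "x \<in> feasible_set P"
    unfolding normalized_nash_def nash_equilibrium_def by blast
  \<comment> \<open>an arbitrary player, whose scaled multipliers represent those of all players\<close>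
  fix \<nu>0 :: 'p
  have "KKT_multipliers P r x (\<lambda>\<nu> j. r \<nu> * lam \<nu> j) (\<lambda>j. r \<nu>0 * Lam \<nu>0 j)"
    unfolding KKT_multipliers_def
  proof (intro conjI allI ballI)
    fix \<nu>
    have "(\<Sum>j\<in>Jshared P. (r \<nu>0 * Lam \<nu>0 j) *\<^sub>R pgrad P \<nu> (Gcon P j) x) =
        (\<Sum>j\<in>Jshared P. (r \<nu> * Lam \<nu> j) *\<^sub>R pgrad P \<nu> (Gcon P j) x)"
      by (intro sum.cong refl) (metis eq)
    then show "r \<nu> *\<^sub>R pgrad P \<nu> (obj P \<nu>) x =
        (\<Sum>j\<in>Jindiv P \<nu>. (r \<nu> * lam \<nu> j) *\<^sub>R pgrad P \<nu> (gcon P \<nu> j) x) +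
        (\<Sum>j\<in>Jshared P. (r \<nu>0 * Lam \<nu>0 j) *\<^sub>R pgrad P \<nu> (Gcon P j) x)"
      by (simp add: stat scaleR_add_right scaleR_sum_right)
  qed (use indiv shared r in \<open>auto simp: less_imp_le\<close>)
  with feas show ?thesis unfolding normalized_KKT_def by blast
qed

theorem theorem3p6:
  fixes P :: "('i::finite, 'p::finite, 'j, 'k) gnep"
    and r :: "'p \<Rightarrow> real"
  assumes "GNEP P"
    and "\<forall>\<nu>. r \<nu> > 0"
  shows "(\<forall>xb. nondegenerate_KKT P r xb \<longrightarrow> locally_unique (normalized_KKT P r) xb) \<and>
         (\<forall>xb. nondegenerate_nash P r xb \<longrightarrow> locally_unique (normalized_nash P r) xb)"
proof (intro conjI allI impI)
  fix xb
  show "locally_unique (normalized_KKT P r) xb" if "nondegenerate_KKT P r xb"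
    using assms(1) that by (rule nondegenerate_KKT_locally_unique)
  then show "locally_unique (normalized_nash P r) xb" if "nondegenerate_nash P r xb"
    using that normalized_nash_imp_KKT[OF assms(2)]
    unfolding nondegenerate_nash_def locally_unique_def by blast
qed

end
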